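(* Let $W$ be a set of weights on $\mathbb{R}^d$ with $w_{\min}>0$ and let $x\in\mathbb{R}^d$. Then $$\frac{\hat\tau_W(x)+w_{\max}}{(1-\hat\tau_W(x))\,w_{\max}}\le\hat\sigma_W(x)\le\frac{\hat\tau_W(x)+w_{\min}}{(1-\hat\tau_W(x))\,w_{\min}}.$$
   Context: A weight is $w=(w_1,\dots,w_d)\in[0,1]^d$ with $\sum_iw_i=1$; define $\|y\|_w:=\max_{i:\,w_i\ne0}|y_i|^{1/w_i}$. For a set of weights $W$: $w_{\min}:=\inf\{w_i:1\le i\le d,\ w\in W\}$, $w_{\max}:=\sup\{w_i:1\le i\le d,\ w\in W\}$. $\hat\sigma_W(x)$ is the supremum of all $\varepsilon$ such that there is $Q_0>0$ with: for every $Q>Q_0$ and every $w\in W$ there is $(p,q)\in\mathbb{Z}^d\times\mathbb{Z}$ with $\|qx-p\|_w\le Q^{-\varepsilon}$ and $0<q\le Q$. Let $a_{w,t}:=\mathrm{diag}(e^{w_1t},\dots,e^{w_dt},e^{-t})$, $u_x:=\begin{pmatrix}I_d&x^T\\0&1\end{pmatrix}$, and for a lattice $\Lambda\subset\mathbb{R}^{d+1}$ let $\delta(\Lambda):=\min_{0\ne v\in\Lambda}\|v\|_\infty$. Define $\hat\tau_W(x):=\liminf_{t\to\infty}\inf_{w\in W}\frac{-1}{t}\log\delta(a_{w,t}u_x\mathbb{Z}^{d+1})$. *)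

theory Defs
  imports "HOL-Analysis.Analysis"
begin

definition is_weight :: "real ^ 'n \<Rightarrow> bool" where
  "is_weight w \<longleftrightarrow> (\<forall>i. 0 \<le> w $ i \<and> w $ i \<le> 1) \<and> (\<Sum>i\<in>UNIV. w $ i) = 1"

definition w_quasinorm :: "real ^ 'n \<Rightarrow> real ^ 'n \<Rightarrow> real" where
  "w_quasinorm w y = Max ((\<lambda>i. \<bar>y $ i\<bar> powr (1 / w $ i)) ` {i. w $ i \<noteq> 0})"

definition w_min :: "(real ^ 'n) set \<Rightarrow> real" where
  "w_min W = Inf {w $ i | w i. w \<in> W}"

definition w_max :: "(real ^ 'n) set \<Rightarrow> real" where
  "w_max W = Sup {w $ i | w i. w \<in> W}"

text \<open>The supremum is taken in the extended reals: it equals \<open>\<infinity>\<close> for rational \<open>x\<close>.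
  In that case \<open>tau_hat W x = 1\<close>, and quotients by \<open>1 - tau_hat W x\<close> follow the convention of
  \<^typ>\<open>ereal\<close> that \<open>a / 0 = \<infinity>\<close> for \<open>a > 0\<close>.\<close>

definition sigma_hat :: "(real ^ 'n) set \<Rightarrow> real ^ 'n \<Rightarrow> ereal" where
  "sigma_hat W x = Sup (ereal ` {\<epsilon>. \<exists>Q0>0. \<forall>Q>Q0. \<forall>w\<in>W.
     \<exists>(p :: int ^ 'n) (q :: int).
       w_quasinorm w (of_int q *\<^sub>R x - (\<chi> i. of_int (p $ i))) \<le> Q powr (- \<epsilon>)
       \<and> 0 < q \<and> of_int q \<le> Q})"

text \<open>\<open>\<real>\<^sup>d\<^sup>+\<^sup>1\<close> is \<^typ>\<open>real ^ ('n + unit)\<close>; \<^term>\<open>Inl i\<close> are the first \<open>d\<close>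
  coordinates and \<^term>\<open>Inr ()\<close> is the last one.\<close>

definition diag_mat :: "real ^ 'm \<Rightarrow> real ^ 'm ^ 'm" where
  "diag_mat v = (\<chi> i j. if i = j then v $ i else 0)"

definition a_mat :: "real ^ 'n \<Rightarrow> real \<Rightarrow> real ^ ('n + unit) ^ ('n + unit)" where
  "a_mat w t = diag_mat (\<chi> k. case k of Inl i \<Rightarrow> exp (w $ i * t) | Inr _ \<Rightarrow> exp (- t))"

definition u_mat :: "real ^ 'n \<Rightarrow> real ^ ('n + unit) ^ ('n + unit)" where
  "u_mat x = (\<chi> k l. case k of
       Inl i \<Rightarrow> (case l of Inl j \<Rightarrow> (if i = j then 1 else 0) | Inr _ \<Rightarrow> x $ i)
     | Inr _ \<Rightarrow> (case l of Inl j \<Rightarrow> 0 | Inr _ \<Rightarrow> 1))"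

definition int_lattice :: "(real ^ 'm) set" where
  "int_lattice = {v. \<forall>i. v $ i \<in> \<int>}"

text \<open>For a lattice \<open>\<Lambda>\<close> the infimum is a minimum, because \<open>\<Lambda>\<close> is discrete and nonzero.\<close>

definition lattice_delta :: "(real ^ 'm) set \<Rightarrow> real" where
  "lattice_delta \<Lambda> = (INF v \<in> \<Lambda> - {0}. infnorm v)"

definition tau_hat :: "(real ^ 'n) set \<Rightarrow> real ^ 'n \<Rightarrow> ereal" where
  "tau_hat W x = Liminf at_top (\<lambda>t :: real. INF w\<in>W.
     ereal (- 1 / t * ln (lattice_delta ((\<lambda>v. (a_mat w t ** u_mat x) *v v) ` int_lattice))))"

end

theory Submission
  imports Defs
begin

text \<open>
  A short vector of \<open>a\<^sub>w\<^sub>,\<^sub>t u\<^sub>x \<int>\<^sup>d\<^sup>+\<^sup>1\<close> of norm at most \<open>e\<^sup>-\<^sup>s\<^sup>t\<close> is a pair \<open>(p, q)\<close> with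
  \<open>\<bar>q\<bar> \<le> e\<^sup>(\<^sup>1\<^sup>-\<^sup>s\<^sup>)\<^sup>t\<close> and \<open>\<bar>q x\<^sub>i - p\<^sub>i\<bar> \<le> e\<close> to the power \<open>-(w\<^sub>i + s) t\<close>. Substituting
  \<open>Q = e\<^sup>(\<^sup>1\<^sup>-\<^sup>s\<^sup>)\<^sup>t\<close>, this is an approximation of quality \<open>\<epsilon>\<close> in direction \<open>i\<close> exactly when
  \<open>\<epsilon> (1 - s) = 1 + s / w\<^sub>i\<close>, and for \<open>s \<ge> 0\<close> the right-hand side lies between its values at
  \<open>w_max\<close> and \<open>w_min\<close>. The sign of \<open>s\<close> matters here, so the weighted Dirichlet theorem
  is needed to know that \<open>tau_hat\<close> is nonnegative.
\<close>

section \<open>Sup norm and coordinates of the lattice vectors\<close>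

lemma infnorm_le_iff_cart:
  fixes v :: "real ^ 'm"
  shows "infnorm v \<le> c \<longleftrightarrow> (\<forall>i. \<bar>v $ i\<bar> \<le> c)"
proof -
  have "infnorm v = Max (range (\<lambda>i. \<bar>v $ i\<bar>))"
    unfolding infnorm_cart by (subst cSup_eq_Max) (auto simp: full_SetCompr_eq)
  then show ?thesis
    by (simp add: Max_le_iff)
qed

lemma component_le_infnorm_cart: "\<bar>v $ i\<bar> \<le> infnorm v" for v :: "real ^ 'm"
  using infnorm_le_iff_cart[of v "infnorm v"] by simp

text \<open>The integer vector \<open>p\<close> enters with a minus sign so that the first
  coordinates are rescaled errors \<open>q x - p\<close>, as in \<open>sigma_hat\<close>. Since
  \<open>p\<close> ranges over all integer vectors, the sign change permutes the lattice
  points.\<close>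

definition lattice_point :: "real ^ 'n \<Rightarrow> real ^ 'n \<Rightarrow> real \<Rightarrow> int ^ 'n \<Rightarrow> int \<Rightarrow> real ^ ('n + unit)"
  where "lattice_point w x t p q = (\<chi> k. case k of
    Inl i \<Rightarrow> exp (w $ i * t) * (of_int q * x $ i - of_int (p $ i))
  | Inr _ \<Rightarrow> exp (- t) * of_int q)"

lemma sum_UNIV_Plus_unit:
  fixes f :: "'n::finite + unit \<Rightarrow> 'a::comm_monoid_add"
  shows "sum f UNIV = (\<Sum>i\<in>UNIV. f (Inl i)) + f (Inr ())"
  by (subst UNIV_Plus_UNIV[symmetric], subst sum.Plus) (auto simp: UNIV_unit)

lemma a_mat_u_mat_mult:
  "(a_mat w t ** u_mat x) *v v = (\<chi> k. case k of
     Inl i \<Rightarrow> exp (w $ i * t) * (v $ Inl i + v $ Inr () * x $ i)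
   | Inr _ \<Rightarrow> exp (- t) * v $ Inr ())"
proof -
  have diag: "diag_mat d *v y = (\<chi> k. d $ k * y $ k)" for d y :: "real ^ 'm"
    by (simp add: vec_eq_iff diag_mat_def matrix_vector_mult_def if_distrib[of "\<lambda>a. a * _"] cong: if_cong)
  have u: "u_mat x *v v = (\<chi> k. case k of Inl i \<Rightarrow> v $ Inl i + v $ Inr () * x $ i | Inr _ \<Rightarrow> v $ Inr ())"
    by (auto simp: vec_eq_iff u_mat_def matrix_vector_mult_def sum_UNIV_Plus_unit
        if_distrib[of "\<lambda>a. a * _"] split: sum.splits cong: if_cong)
  show ?thesis
    unfolding matrix_vector_mul_assoc[symmetric] u a_mat_def diag
    by (auto simp: vec_eq_iff split: sum.splits)
qed

lemma image_int_lattice: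
  "(\<lambda>v. (a_mat w t ** u_mat x) *v v) ` int_lattice = {lattice_point w x t p q | p q. True}"
proof (intro equalityI subsetI)
  fix y assume "y \<in> (\<lambda>v. (a_mat w t ** u_mat x) *v v) ` int_lattice"
  then obtain v where v: "\<And>k. v $ k \<in> \<int>" "y = (a_mat w t ** u_mat x) *v v"
    by (auto simp: int_lattice_def)
  from v(1) have "\<forall>k. \<exists>n::int. v $ k = of_int n"
    by (auto simp: Ints_def)
  then obtain n where n: "\<And>k. v $ k = of_int (n k)"
    by metis
  have "y = lattice_point w x t (\<chi> i. - n (Inl i)) (n (Inr ()))"
    unfolding v(2) a_mat_u_mat_mult lattice_point_def
    by (auto simp: vec_eq_iff n split: sum.splits)
  then show "y \<in> {lattice_point w x t p q | p q. True}"
    by blast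
next
  fix y assume "y \<in> {lattice_point w x t p q | p q. True}"
  then obtain p q where y: "y = lattice_point w x t p q"
    by blast
  let ?v = "(\<chi> k. case k of Inl i \<Rightarrow> - of_int (p $ i) | Inr _ \<Rightarrow> of_int q) :: real ^ ('a + unit)"
  have "?v \<in> int_lattice"
    by (auto simp: int_lattice_def split: sum.splits)
  moreover have "y = (a_mat w t ** u_mat x) *v ?v"
    unfolding y a_mat_u_mat_mult lattice_point_def by (auto simp: vec_eq_iff split: sum.splits)
  ultimately show "y \<in> (\<lambda>v. (a_mat w t ** u_mat x) *v v) ` int_lattice"
    by blast
qed

section \<open>Short lattice vectors as integer approximations\<close>

definition orbit_delta :: "real ^ 'n \<Rightarrow> real ^ 'n \<Rightarrow> real \<Rightarrow> real"
  where "orbit_delta w x t = lattice_delta ((\<lambda>v. (a_mat w t ** u_mat x) *v v) ` int_lattice)"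

lemma tau_hat_eq:
  "tau_hat W x = Liminf at_top (\<lambda>t. INF w\<in>W. ereal (- 1 / t * ln (orbit_delta w x t)))"
  by (simp add: tau_hat_def orbit_delta_def)

lemma lattice_point_nonzero: "q \<noteq> 0 \<Longrightarrow> lattice_point w x t p q \<noteq> 0"
  by (auto simp: vec_eq_iff lattice_point_def intro!: exI[of _ "Inr ()"])

lemma orbit_delta_le:
  assumes "q \<noteq> 0" and "\<And>i. exp (w $ i * t) * \<bar>of_int q * x $ i - of_int (p $ i)\<bar> \<le> c"
    and "exp (- t) * \<bar>of_int q\<bar> \<le> c"
  shows "orbit_delta w x t \<le> c"
proof -
  have "bdd_below (infnorm ` ({lattice_point w x t p q | p q. True} - {0}))"
    by (rule bdd_belowI[of _ 0]) (auto simp: infnorm_pos_le)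
  then have "orbit_delta w x t \<le> infnorm (lattice_point w x t p q)"
    unfolding orbit_delta_def lattice_delta_def image_int_lattice
    by (rule cINF_lower) (use lattice_point_nonzero[OF assms(1)] in auto)
  also have "\<dots> \<le> c"
    unfolding infnorm_le_iff_cart
    using assms(2,3) by (auto simp: lattice_point_def abs_mult split: sum.splits)
  finally show ?thesis .
qed

text \<open>A strict bound on an infimum is witnessed by some vector, so the witness comes without
  an appeal to attainment of the minimum.\<close>

lemma orbit_delta_less:
  assumes "orbit_delta w x t < c"
  obtains p q where "p \<noteq> 0 \<or> q \<noteq> 0"
    and "\<And>i. exp (w $ i * t) * \<bar>of_int q * x $ i - of_int (p $ i)\<bar> < c"
    and "exp (- t) * \<bar>of_int q\<bar> < c"
proof -
  let ?S = "{lattice_point w x t p q | p q. True} - {0}"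
  have "lattice_point w x t 0 1 \<in> ?S"
    using lattice_point_nonzero[of 1] by auto
  then have ne: "?S \<noteq> {}"
    by blast
  have bdd: "bdd_below (infnorm ` ?S)"
    by (rule bdd_belowI[of _ 0]) (auto simp: infnorm_pos_le)
  from assms have "(INF v \<in> ?S. infnorm v) < c"
    unfolding orbit_delta_def lattice_delta_def image_int_lattice .
  then obtain v where "v \<in> ?S" "infnorm v < c"
    unfolding cINF_less_iff[OF ne bdd] by blast
  then obtain p q where pq: "lattice_point w x t p q \<noteq> 0" "infnorm (lattice_point w x t p q) < c"
    by blast
  have lt: "\<bar>lattice_point w x t p q $ k\<bar> < c" for k
    using component_le_infnorm_cart pq(2) by (rule le_less_trans)
  show ?thesis
  proof
    show "p \<noteq> 0 \<or> q \<noteq> 0"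
    proof (rule ccontr)
      assume "\<not> ?thesis"
      then have "lattice_point w x t p q = 0"
        by (simp add: lattice_point_def vec_eq_iff split: sum.split)
      with pq(1) show False ..
    qed
    show "exp (w $ i * t) * \<bar>of_int q * x $ i - of_int (p $ i)\<bar> < c" for i
      using lt[of "Inl i"] by (simp add: lattice_point_def abs_mult)
    show "exp (- t) * \<bar>of_int q\<bar> < c"
      using lt[of "Inr ()"] by (simp add: lattice_point_def abs_mult)
  qed
qed

text \<open>If \<open>q = 0\<close>, some \<open>p $ i\<close> is a nonzero integer and coordinate
  \<open>i\<close> has size at least \<open>exp (w $ i * t)\<close>, hence at least
  \<open>c\<close>. So \<open>q \<noteq> 0\<close>, and replacing the vector by its negative makes
  \<open>q\<close> positive.\<close>

lemma orbit_delta_less_pos: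
  assumes "orbit_delta w x t < c" and "\<And>i. c \<le> exp (w $ i * t)"
  obtains p q where "0 < q"
    and "\<And>i. exp (w $ i * t) * \<bar>of_int q * x $ i - of_int (p $ i)\<bar> < c"
    and "exp (- t) * of_int q < c"
proof -
  obtain p q where pq: "p \<noteq> 0 \<or> q \<noteq> 0"
    "\<And>i. exp (w $ i * t) * \<bar>of_int q * x $ i - of_int (p $ i)\<bar> < c"
    "exp (- t) * \<bar>of_int q\<bar> < c"
    using orbit_delta_less[OF assms(1)] by blast
  have "q \<noteq> 0"
  proof
    assume "q = 0"
    have "p $ i = 0" for i
    proof -
      have "exp (w $ i * t) * \<bar>of_int (p $ i)\<bar> < exp (w $ i * t) * 1"
        using less_le_trans[OF pq(2)[of i] assms(2)[of i]] \<open>q = 0\<close> by simp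
      then have "\<bar>real_of_int (p $ i)\<bar> < 1"
        by (subst (asm) mult_less_cancel_left_pos) auto
      then show ?thesis
        by linarith
    qed
    with pq(1) \<open>q = 0\<close> show False
      by (simp add: vec_eq_iff)
  qed
  then consider "q > 0" | "q < 0"
    by linarith
  then show ?thesis
  proof cases
    case 1
    with pq show ?thesis
      by (intro that[of q p]) auto
  next
    case 2
    show ?thesis
    proof (rule that[of "- q" "- p"])
      show "0 < - q" "exp (- t) * of_int (- q) < c"
        using pq(3) 2 by simp_all
      have "\<bar>of_int (- q) * x $ i - of_int ((- p) $ i)\<bar> = \<bar>of_int q * x $ i - of_int (p $ i)\<bar>" for i
        by simp
      with pq(2) show "exp (w $ i * t) * \<bar>of_int (- q) * x $ i - of_int ((- p) $ i)\<bar> < c" for i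
        by metis
    qed
  qed
qed

text \<open>A shorter vector would have \<open>q \<ge> 1\<close>, and then its last coordinate alone
  is at least \<open>exp (- t)\<close>. This bound keeps the logarithm meaningful and yields
  \<open>tau_hat W x \<le> 1\<close>.\<close>

lemma orbit_delta_ge:
  assumes "\<And>i. 0 \<le> w $ i" and "0 \<le> t"
  shows "exp (- t) \<le> orbit_delta w x t"
proof (rule ccontr)
  assume "\<not> ?thesis"
  then have "orbit_delta w x t < exp (- t)"
    by simp
  moreover have "exp (- t) \<le> exp (w $ i * t)" for i
    using assms(1)[of i] assms(2) by (simp add: order_trans[of "- t" 0])
  ultimately obtain q :: int where q: "0 < q" "exp (- t) * of_int q < exp (- t)"
    using orbit_delta_less_pos by metis
  from q(2) have "real_of_int q < 1"
    by simp
  with q(1) show False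
    by linarith
qed

section \<open>Weighted Dirichlet theorem\<close>

text \<open>Weighted Dirichlet theorem, up to a constant: pigeonhole on a grid with \<open>\<lfloor>exp (w\<^sub>i t)\<rfloor>\<close> cells
  in direction \<open>i\<close>.\<close>

lemma orbit_delta_le_2:
  fixes w x :: "real ^ 'n"
  assumes "is_weight w" and "0 \<le> t"
  shows "orbit_delta w x t \<le> 2"
proof -
  define N where "N i = nat \<lfloor>exp (w $ i * t)\<rfloor>" for i
  define M where "M = (\<Prod>i\<in>UNIV. N i)"
  define cell where "cell k = (\<lambda>i. nat \<lfloor>frac (of_nat k * x $ i) * of_nat (N i)\<rfloor>)" for k :: nat
  have wt: "0 \<le> w $ i * t" for i
    using assms by (simp add: is_weight_def)
  have N_real: "real (N i) = of_int \<lfloor>exp (w $ i * t)\<rfloor>" for i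
    by (simp add: N_def)
  have N1: "1 \<le> N i" for i
  proof -
    have "1 \<le> \<lfloor>exp (w $ i * t)\<rfloor>"
      using wt[of i] by (simp add: le_floor_iff)
    then show ?thesis
      unfolding N_def by linarith
  qed
  have Nle: "real (N i) \<le> exp (w $ i * t)" for i
    unfolding N_real by (rule of_int_floor_le)
  \<comment> \<open>Rounding down a number that is at least 1 loses less than a factor 2; this is
    the source of the constant 2 in the lemma.\<close>
  have N2: "exp (w $ i * t) \<le> 2 * real (N i)" for i
  proof -
    have "exp (w $ i * t) < real (N i) + 1"
      unfolding N_real by linarith
    with N1[of i] show ?thesis
      by linarith
  qed
  \<comment> \<open>The weights sum to 1, so there are at most \<open>exp t\<close> cells; this
    later bounds the denominator \<open>l - k\<close>.\<close>
  have "real M \<le> (\<Prod>i\<in>UNIV. exp (w $ i * t))"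
    unfolding M_def of_nat_prod by (rule prod_mono) (simp add: Nle)
  also have "\<dots> = exp t"
    using assms(1) by (simp add: exp_sum[symmetric] sum_distrib_right[symmetric] is_weight_def)
  finally have M: "real M \<le> exp t" .
  have "cell ` {0..M} \<subseteq> (\<Pi>\<^sub>E i\<in>UNIV. {..<N i})"
  proof (clarsimp simp: PiE_def Pi_def extensional_def)
    fix k i
    have "frac (of_nat k * x $ i) * of_nat (N i) < 1 * of_nat (N i)"
      using N1[of i] by (intro mult_strict_right_mono) (auto simp: frac_lt_1)
    then have "\<lfloor>frac (of_nat k * x $ i) * of_nat (N i)\<rfloor> < int (N i)"
      by (simp add: floor_less_iff)
    then show "cell k i < N i"
      using N1[of i] unfolding cell_def by linarith
  qed
  \<comment> \<open>The \<open>M + 1\<close> multiples \<open>0, ..., M\<close> of \<open>x\<close>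
    fall into at most \<open>M\<close> cells, so two of them share one.\<close>
  then have "card (cell ` {0..M}) \<le> M"
    unfolding M_def using card_mono[of "\<Pi>\<^sub>E i\<in>UNIV. {..<N i}"] by (simp add: card_PiE finite_PiE)
  then have "\<not> inj_on cell {0..M}"
    using card_image[of cell "{0..M}"] by auto
  then obtain k l where kl: "k \<le> M" "l \<le> M" "k < l" "cell k = cell l"
    unfolding inj_on_def by (metis atLeastAtMost_iff linorder_neqE_nat)
  \<comment> \<open>With this \<open>p\<close>, the error \<open>(l - k) x - p\<close> is a
    difference of fractional parts, which is less than \<open>1 / N i\<close> within one
    cell.\<close>
  define p where "p = (\<chi> i. \<lfloor>of_nat l * x $ i\<rfloor> - \<lfloor>of_nat k * x $ i\<rfloor>)"
  have close: "\<bar>(of_nat l - of_nat k) * x $ i - of_int (p $ i)\<bar> * N i < 1" for i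
  proof -
    \<comment> \<open>\<open>nat\<close> sends all negative integers to 0, so equal cells give equal
      floors only once the floors are known to be nonnegative.\<close>
    have nonneg: "0 \<le> frac (of_nat j * x $ i) * of_nat (N i)" for j :: nat
      by simp
    have "\<lfloor>frac (of_nat k * x $ i) * of_nat (N i)\<rfloor> = \<lfloor>frac (of_nat l * x $ i) * of_nat (N i)\<rfloor>"
      using fun_cong[OF kl(4), of i] nonneg[of k] nonneg[of l] unfolding cell_def
      by (metis eq_nat_nat_iff zero_le_floor)
    then have "\<bar>frac (of_nat l * x $ i) * of_nat (N i) - frac (of_nat k * x $ i) * of_nat (N i)\<bar> < 1"
      by linarith
    then show ?thesis
      unfolding left_diff_distrib[symmetric] abs_mult
      by (simp add: p_def frac_def) (simp add: algebra_simps)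
  qed
  show ?thesis
  proof (rule orbit_delta_le)
    show "int l - int k \<noteq> 0"
      using kl(3) by simp
    show "exp (w $ i * t) * \<bar>of_int (int l - int k) * x $ i - of_int (p $ i)\<bar> \<le> 2" for i
    proof -
      have "exp (w $ i * t) * \<bar>(of_nat l - of_nat k) * x $ i - of_int (p $ i)\<bar>
          \<le> 2 * real (N i) * \<bar>(of_nat l - of_nat k) * x $ i - of_int (p $ i)\<bar>"
        by (rule mult_right_mono[OF N2]) simp
      with close[of i] show ?thesis
        by (simp add: mult_ac)
    qed
    have "\<bar>real l - real k\<bar> \<le> exp t"
      using kl M by linarith
    then show "exp (- t) * \<bar>of_int (int l - int k)\<bar> \<le> 2"
      by (simp add: exp_minus divide_simps)
  qed
qed

section \<open>The weighted quasinorm, coordinate by coordinate\<close>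

lemma w_quasinorm_le_iff:
  fixes w y :: "real ^ 'n"
  assumes "\<And>i. 0 < w $ i"
  shows "w_quasinorm w y \<le> c \<longleftrightarrow> (\<forall>i. \<bar>y $ i\<bar> powr (1 / w $ i) \<le> c)"
proof -
  have "{i. w $ i \<noteq> 0} = UNIV"
    using assms by (auto simp: less_imp_neq[symmetric])
  then show ?thesis
    by (simp add: w_quasinorm_def Max_le_iff)
qed

text \<open>Taking powers \<open>a\<close> and \<open>1 / a\<close> is monotone on nonnegative
  reals. The case \<open>y = 0\<close> is covered because \<open>0 powr z = 0\<close>.\<close>

lemma powr_inverse_weight_le_iff:
  assumes "0 < (a::real)" and "0 < Q"
  shows "\<bar>y\<bar> powr (1 / a) \<le> Q powr (- \<epsilon>) \<longleftrightarrow> \<bar>y\<bar> \<le> Q powr (- (\<epsilon> * a))"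
proof -
  have "\<bar>y\<bar> \<le> Q powr (- (\<epsilon> * a))" if "\<bar>y\<bar> powr (1 / a) \<le> Q powr (- \<epsilon>)"
    using powr_mono2[OF _ _ that, of a] assms by (simp add: powr_powr)
  moreover have "\<bar>y\<bar> powr (1 / a) \<le> Q powr (- \<epsilon>)" if "\<bar>y\<bar> \<le> Q powr (- (\<epsilon> * a))"
    using powr_mono2[OF _ _ that, of "1 / a"] assms by (simp add: powr_powr)
  ultimately show ?thesis
    by blast
qed

text \<open>For empty \<open>W\<close> the infimum in \<open>tau_hat\<close> would be
  \<open>\<infinity>\<close>. A positive \<open>w_min W\<close> makes every weight coordinate
  positive, so \<open>w_quasinorm\<close> sees all coordinates.\<close>

locale weight_family =
  fixes W :: "(real ^ 'n) set"
  assumes nonempty: "W \<noteq> {}"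
    and weight: "\<And>w. w \<in> W \<Longrightarrow> is_weight w"
    and w_min_pos: "0 < w_min W"
begin

lemma w_min_le: "w \<in> W \<Longrightarrow> w_min W \<le> w $ i"
  unfolding w_min_def using weight
  by (intro cInf_lower bdd_belowI[of _ 0]) (auto simp: is_weight_def)

lemma w_max_ge: "w \<in> W \<Longrightarrow> w $ i \<le> w_max W"
  unfolding w_max_def using weight
  by (intro cSup_upper bdd_aboveI[of _ 1]) (auto simp: is_weight_def)

lemma weight_pos: "w \<in> W \<Longrightarrow> 0 < w $ i"
  using w_min_le w_min_pos by (rule order.strict_trans2[rotated])

lemma w_max_pos: "0 < w_max W"
proof -
  obtain w where "w \<in> W"
    using nonempty by blast
  then show ?thesis
    using less_le_trans[OF weight_pos w_max_ge] by blast
qed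

lemma orbit_delta_pos:
  assumes "w \<in> W" and "0 \<le> t"
  shows "0 < orbit_delta w x t"
  using orbit_delta_ge[of w t x] weight_pos[OF assms(1)] assms(2) exp_gt_zero[of "- t"]
  by (meson less_imp_le less_le_trans)

section \<open>The range of \<open>tau_hat\<close>\<close>

lemma tau_hat_le_1: "tau_hat W x \<le> 1"
proof -
  have "(INF w\<in>W. ereal (- 1 / t * ln (orbit_delta w x t))) \<le> 1" if "t > 0" for t
  proof -
    obtain w where w: "w \<in> W"
      using nonempty by blast
    have "- t \<le> ln (orbit_delta w x t)"
      using orbit_delta_ge[of w t x] weight_pos[OF w] orbit_delta_pos[OF w, of t x] \<open>t > 0\<close>
      by (simp add: ln_ge_iff less_imp_le)
    then have "- 1 / t * ln (orbit_delta w x t) \<le> 1"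
      using \<open>t > 0\<close> by (simp add: field_simps)
    then show ?thesis
      using w by (intro INF_lower2[of w]) auto
  qed
  then have "Limsup at_top (\<lambda>t. INF w\<in>W. ereal (- 1 / t * ln (orbit_delta w x t))) \<le> 1"
    by (intro Limsup_bounded eventually_mono[OF eventually_gt_at_top[of 0]]) auto
  then show ?thesis
    unfolding tau_hat_eq by (rule order_trans[OF Liminf_le_Limsup[OF trivial_limit_at_top_linorder]])
qed

text \<open>The constant 2 of the Dirichlet bound contributes only \<open>- ln 2 / t\<close>, which
  vanishes in the limit, uniformly in \<open>w\<close>.\<close>

lemma tau_hat_nonneg: "0 \<le> tau_hat W x"
proof -
  have "((\<lambda>t::real. - 1 / t * ln 2) \<longlongrightarrow> 0) at_top"
    by (intro tendsto_mult_left_zero tendsto_divide_0[OF tendsto_const] filterlim_at_top_imp_at_infinity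
        filterlim_ident)
  then have "((\<lambda>t::real. ereal (- 1 / t * ln 2)) \<longlongrightarrow> 0) at_top"
    by (simp add: zero_ereal_def)
  then have "0 = Liminf at_top (\<lambda>t::real. ereal (- 1 / t * ln 2))"
    by (simp add: lim_imp_Liminf)
  also have "\<dots> \<le> tau_hat W x"
    unfolding tau_hat_eq
  proof (intro Liminf_mono eventually_mono[OF eventually_gt_at_top[of 0]] INF_greatest)
    fix t :: real and w assume *: "0 < t" "w \<in> W"
    have "ln (orbit_delta w x t) \<le> ln 2"
      using orbit_delta_le_2[OF weight, of w t x] orbit_delta_pos[of w t x] * by simp
    then show "ereal (- 1 / t * ln 2) \<le> ereal (- 1 / t * ln (orbit_delta w x t))"
      using *(1) by (simp add: divide_right_mono)
  qed
  finally show ?thesis .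
qed

section \<open>Transfer between short vectors and approximation exponents\<close>

text \<open>Negative \<open>s\<close> is needed when \<open>tau_hat W x = 0\<close>; the factor \<open>1 + s / w\<^sub>i\<close> is then
  smallest at \<open>w_min W\<close>.\<close>

lemma sigma_hat_ge:
  assumes s: "ereal s < tau_hat W x" and "- w_min W < s"
  shows "ereal ((1 + min (s / w_max W) (s / w_min W)) / (1 - s)) \<le> sigma_hat W x"
proof -
  define \<epsilon> where "\<epsilon> = (1 + min (s / w_max W) (s / w_min W)) / (1 - s)"
  have "s < 1"
    using less_le_trans[OF s tau_hat_le_1] by simp
  have exponent: "\<epsilon> * (1 - s) * w $ i \<le> w $ i + s" if "w \<in> W" for w i
  proof -
    \<comment> \<open>The quotient \<open>s / w $ i\<close> is decreasing in the weight for
      \<open>s \<ge> 0\<close> and increasing for \<open>s < 0\<close>; the minimum covers both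
      signs.\<close>
    have "min (s / w_max W) (s / w_min W) \<le> s / w $ i"
    proof (cases "s \<ge> 0")
      case True
      then have "s / w_max W \<le> s / w $ i"
        using weight_pos[OF that] w_max_ge[OF that] w_max_pos
        by (intro divide_left_mono mult_pos_pos) auto
      then show ?thesis by simp
    next
      case False
      then have "s / w_min W \<le> s / w $ i"
        using w_min_pos w_min_le[OF that] weight_pos[OF that]
        by (intro divide_left_mono_neg) auto
      then show ?thesis by simp
    qed
    then have "\<epsilon> * (1 - s) \<le> 1 + s / w $ i"
      using \<open>s < 1\<close> by (simp add: \<epsilon>_def)
    then have "\<epsilon> * (1 - s) * w $ i \<le> (1 + s / w $ i) * w $ i"
      using weight_pos[OF that, of i] by (intro mult_right_mono) auto
    moreover have "(1 + s / w $ i) * w $ i = w $ i + s"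
      using weight_pos[OF that, of i] by (simp add: field_simps)
    ultimately show ?thesis
      by simp
  qed
  from s have "eventually (\<lambda>t. ereal s < (INF w\<in>W. ereal (- 1 / t * ln (orbit_delta w x t)))) at_top"
    unfolding tau_hat_eq by (rule less_LiminfD)
  then obtain T where T: "\<And>t. t \<ge> T \<Longrightarrow> ereal s < (INF w\<in>W. ereal (- 1 / t * ln (orbit_delta w x t)))"
    unfolding eventually_at_top_linorder by blast
  \<comment> \<open>The image of \<open>max T 1\<close> under
    \<open>t \<mapsto> exp ((1 - s) * t)\<close>. Including 1 forces \<open>t > 0\<close>;
    \<open>T\<close> does not depend on \<open>w\<close>, and hence neither does
    \<open>Q0\<close>.\<close>
  define Q0 where "Q0 = exp ((1 - s) * max T 1)"
  have "\<exists>(p :: int ^ 'n) (q :: int).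
       w_quasinorm w (of_int q *\<^sub>R x - (\<chi> i. of_int (p $ i))) \<le> Q powr (- \<epsilon>)
       \<and> 0 < q \<and> of_int q \<le> Q" if Q: "Q > Q0" and w: "w \<in> W" for Q w
  proof -
    define t where "t = ln Q / (1 - s)"
    have "0 < Q"
      using Q exp_gt_zero unfolding Q0_def by (rule less_trans[rotated])
    have Qt: "Q = exp ((1 - s) * t)"
      using \<open>0 < Q\<close> \<open>s < 1\<close> by (simp add: t_def)
    have t: "t > max T 1"
      using Q \<open>s < 1\<close> by (simp add: Qt Q0_def del: max_less_iff_conj)
    have "ereal s < ereal (- 1 / t * ln (orbit_delta w x t))"
      using less_le_trans[OF T[of t] INF_lower[OF w]] t by simp
    then have "ln (orbit_delta w x t) < - (s * t)"
      using t by (simp add: field_simps)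
    then have lt: "orbit_delta w x t < exp (- (s * t))"
      using orbit_delta_pos[OF w, of t x] t exp_less_mono[of "ln (orbit_delta w x t)"] by simp
    \<comment> \<open>Here \<open>- w_min W < s\<close> enters: it rules out short vectors with
      \<open>q = 0\<close>.\<close>
    have "exp (- (s * t)) \<le> exp (w $ i * t)" for i
    proof -
      have "- s * t \<le> w $ i * t"
        using w_min_le[OF w, of i] assms(2) t by (intro mult_right_mono) auto
      then show ?thesis by simp
    qed
    with lt obtain p q where pq: "0 < q"
      "\<And>i. exp (w $ i * t) * \<bar>of_int q * x $ i - of_int (p $ i)\<bar> < exp (- (s * t))"
      "exp (- t) * of_int q < exp (- (s * t))"
      using orbit_delta_less_pos by metis
    have "of_int q \<le> Q"
    proof -
      have "exp t * (exp (- t) * of_int q) \<le> exp t * exp (- (s * t))"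
        using pq(3) by (intro mult_left_mono) auto
      then show ?thesis
        unfolding mult.assoc[symmetric] exp_add[symmetric] by (simp add: Qt algebra_simps)
    qed
    moreover have "\<bar>of_int q * x $ i - of_int (p $ i)\<bar> powr (1 / w $ i) \<le> Q powr (- \<epsilon>)" for i
    proof -
      have "exp (- (w $ i * t)) * (exp (w $ i * t) * \<bar>of_int q * x $ i - of_int (p $ i)\<bar>)
          \<le> exp (- (w $ i * t)) * exp (- (s * t))"
        using pq(2)[of i] by (intro mult_left_mono) auto
      then have "\<bar>of_int q * x $ i - of_int (p $ i)\<bar> \<le> exp (- ((w $ i + s) * t))"
        unfolding mult.assoc[symmetric] exp_add[symmetric] by (simp add: algebra_simps)
      also have "\<dots> \<le> exp (- (\<epsilon> * (1 - s) * w $ i * t))"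
        using mult_right_mono[OF exponent[OF w, of i], of t] t by simp
      also have "\<dots> = Q powr (- (\<epsilon> * w $ i))"
        by (simp add: Qt powr_def mult_ac)
      finally show ?thesis
        using powr_inverse_weight_le_iff[OF weight_pos[OF w] \<open>0 < Q\<close>] by blast
    qed
    ultimately show ?thesis
      using pq(1) by (intro exI[of _ p] exI[of _ q]) (simp add: w_quasinorm_le_iff[OF weight_pos[OF w]])
  qed
  moreover have "Q0 > 0"
    by (simp add: Q0_def)
  ultimately show ?thesis
    unfolding sigma_hat_def \<epsilon>_def[symmetric] by (intro SUP_upper) blast
qed

text \<open>The reverse substitution. For \<open>\<epsilon> \<ge> 1\<close> the resulting
  \<open>s\<close> is nonnegative, so \<open>1 + s / w $ i\<close> is at most its value at
  \<open>w_min W\<close>, and the exponent that is exact there suffices for every coordinate of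
  every weight.\<close>

lemma tau_hat_ge:
  assumes "Q0 > 0" and "1 \<le> \<epsilon>"
    and approx: "\<And>Q w. Q > Q0 \<Longrightarrow> w \<in> W \<Longrightarrow> \<exists>(p :: int ^ 'n) (q :: int).
       w_quasinorm w (of_int q *\<^sub>R x - (\<chi> i. of_int (p $ i))) \<le> Q powr (- \<epsilon>)
       \<and> 0 < q \<and> of_int q \<le> Q"
  shows "ereal (w_min W * (\<epsilon> - 1) / (1 + \<epsilon> * w_min W)) \<le> tau_hat W x"
proof -
  define m where "m = w_min W"
  have m: "m > 0"
    using w_min_pos by (simp add: m_def)
  \<comment> \<open>The solution of \<open>\<epsilon> * (1 - s) = 1 + s / m\<close>.\<close>
  define s where "s = m * (\<epsilon> - 1) / (1 + \<epsilon> * m)"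
  have den: "1 + \<epsilon> * m > 0"
    using m \<open>1 \<le> \<epsilon>\<close> by (intro add_pos_nonneg) auto
  have "0 \<le> s"
    using m \<open>1 \<le> \<epsilon>\<close> den by (simp add: s_def)
  have s1: "1 - s = (1 + m) / (1 + \<epsilon> * m)"
    using den by (simp add: s_def field_simps)
  also have "\<dots> > 0"
    using m den by simp
  finally have "s < 1"
    by simp
  have s_eq: "\<epsilon> * (1 - s) * m = m + s"
    unfolding s1 using den by (simp add: s_def field_simps)
  have exponent: "w $ i + s \<le> \<epsilon> * (1 - s) * w $ i" if "w \<in> W" for w i
  proof -
    have "\<epsilon> * (1 - s) = 1 + s / m"
      using s_eq m by (simp add: field_simps)
    moreover have "s / w $ i \<le> s / m"
      using \<open>0 \<le> s\<close> w_min_le[OF that, of i] m weight_pos[OF that, of i]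
      by (intro divide_left_mono) (auto simp: m_def)
    ultimately have "(1 + s / w $ i) * w $ i \<le> \<epsilon> * (1 - s) * w $ i"
      using weight_pos[OF that, of i] by (intro mult_right_mono) auto
    moreover have "(1 + s / w $ i) * w $ i = w $ i + s"
      using weight_pos[OF that, of i] by (simp add: field_simps)
    ultimately show ?thesis
      by simp
  qed
  \<comment> \<open>The threshold on \<open>t\<close> gives \<open>t > 0\<close> and
    \<open>exp ((1 - s) * t) > Q0\<close>, for all weights at once.\<close>
  have "ereal s \<le> (INF w\<in>W. ereal (- 1 / t * ln (orbit_delta w x t)))"
    if t: "t > max 0 (ln Q0 / (1 - s))" for t
  proof (rule INF_greatest)
    fix w assume w: "w \<in> W"
    define Q where "Q = exp ((1 - s) * t)"
    have "ln Q0 < (1 - s) * t"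
      using t \<open>s < 1\<close> by (simp add: field_simps)
    then have "Q0 < Q"
      using exp_less_mono[of "ln Q0"] \<open>Q0 > 0\<close> by (simp add: Q_def)
    then obtain p :: "int ^ 'n" and q :: int where
      pq: "w_quasinorm w (of_int q *\<^sub>R x - (\<chi> i. of_int (p $ i))) \<le> Q powr (- \<epsilon>)"
        "0 < q" "of_int q \<le> Q"
      using approx w by blast
    have "orbit_delta w x t \<le> exp (- (s * t))"
    proof (rule orbit_delta_le)
      show "q \<noteq> 0"
        using pq(2) by simp
      have "exp (- t) * real_of_int q \<le> exp (- t) * Q"
        using pq(3) by simp
      also have "\<dots> = exp (- (s * t))"
        by (simp add: Q_def exp_add[symmetric] algebra_simps)
      finally show "exp (- t) * \<bar>of_int q\<bar> \<le> exp (- (s * t))"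
        using pq(2) by simp
    next
      fix i
      have "\<bar>of_int q * x $ i - of_int (p $ i)\<bar> powr (1 / w $ i) \<le> Q powr (- \<epsilon>)"
        using pq(1) by (simp add: w_quasinorm_le_iff[OF weight_pos[OF w]])
      then have "\<bar>of_int q * x $ i - of_int (p $ i)\<bar> \<le> Q powr (- (\<epsilon> * w $ i))"
        using powr_inverse_weight_le_iff[OF weight_pos[OF w], of Q] by (simp add: Q_def)
      also have "\<dots> = exp (- (\<epsilon> * (1 - s) * w $ i * t))"
        by (simp add: Q_def powr_def mult_ac)
      also have "\<dots> \<le> exp (- ((w $ i + s) * t))"
        using mult_right_mono[OF exponent[OF w, of i], of t] t by simp
      finally have "exp (w $ i * t) * \<bar>of_int q * x $ i - of_int (p $ i)\<bar>
          \<le> exp (w $ i * t) * exp (- ((w $ i + s) * t))"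
        by (intro mult_left_mono) auto
      then show "exp (w $ i * t) * \<bar>of_int q * x $ i - of_int (p $ i)\<bar> \<le> exp (- (s * t))"
        by (simp add: exp_add[symmetric] algebra_simps)
    qed
    then have "ln (orbit_delta w x t) \<le> ln (exp (- (s * t)))"
      using orbit_delta_pos[OF w, of t x] t by (intro ln_mono) auto
    then show "ereal s \<le> ereal (- 1 / t * ln (orbit_delta w x t))"
      using t by (simp add: field_simps)
  qed
  then have "ereal s \<le> tau_hat W x"
    unfolding tau_hat_eq
    by (intro Liminf_bounded eventually_mono[OF eventually_gt_at_top[of "max 0 (ln Q0 / (1 - s))"]]) auto
  then show ?thesis
    by (simp add: s_def m_def)
qed

section \<open>The two inequalities\<close>

lemma tau_hat_real:
  obtains r where "tau_hat W x = ereal r" "0 \<le> r" "r \<le> 1"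
  using tau_hat_nonneg[of x] tau_hat_le_1[of x] by (cases "tau_hat W x") auto

text \<open>\<open>sigma_hat_ge\<close> requires \<open>s\<close> strictly below
  \<open>tau_hat W x\<close>, so for \<open>r < 1\<close> the bound is reached as a left limit; as
  \<open>r \<ge> 0\<close>, the minimum at \<open>r\<close> is \<open>r / w_max W\<close>. For
  \<open>r = 1\<close> the values \<open>h s\<close> are unbounded, which forces
  \<open>sigma_hat W x = \<infinity>\<close>.\<close>

lemma sigma_hat_lower_bound:
  "(tau_hat W x + ereal (w_max W)) / ((1 - tau_hat W x) * ereal (w_max W)) \<le> sigma_hat W x"
proof -
  define h where "h s = (1 + min (s / w_max W) (s / w_min W)) / (1 - s)" for s
  obtain r where r: "tau_hat W x = ereal r" "0 \<le> r" "r \<le> 1"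
    by (rule tau_hat_real)
  have ge: "ereal (h s) \<le> sigma_hat W x" if "- w_min W < s" "s < r" for s
    unfolding h_def using that r by (intro sigma_hat_ge) auto
  show ?thesis
  proof (cases "r < 1")
    case True
    have "(h \<longlongrightarrow> h r) (at_left r)"
      unfolding h_def using True w_max_pos w_min_pos by (intro tendsto_intros) auto
    then have "((\<lambda>s. ereal (h s)) \<longlongrightarrow> ereal (h r)) (at_left r)"
      by simp
    \<comment> \<open>When \<open>r = 0\<close>, every \<open>s\<close> to the left of
      \<open>r\<close> is negative, so the interval has to start at
      \<open>- w_min W\<close>.\<close>
    moreover have "eventually (\<lambda>s. ereal (h s) \<le> sigma_hat W x) (at_left r)"
      using ge r(2) w_min_pos by (intro eventually_at_leftI[of "- w_min W"]) auto
    ultimately have "ereal (h r) \<le> sigma_hat W x"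
      by (rule tendsto_upperbound) simp
    moreover have "h r = (r + w_max W) / ((1 - r) * w_max W)"
    proof -
      have "w_min W \<le> w_max W"
        using nonempty order_trans[OF w_min_le w_max_ge] by blast
      then have "r / w_max W \<le> r / w_min W"
        using w_min_pos w_max_pos r(2) by (intro divide_left_mono) auto
      then show ?thesis
        using w_max_pos True by (simp add: h_def field_simps)
    qed
    ultimately show ?thesis
      using True w_max_pos by (simp add: r(1) one_ereal_def)
  next
    case False
    with r(3) have "r = 1"
      by simp
    have "ereal B \<le> sigma_hat W x" if "B \<ge> 1" for B
    proof -
      \<comment> \<open>Chosen so that \<open>1 / (1 - s) = B\<close>; for \<open>s \<ge> 0\<close>
        this is a lower bound of \<open>h s\<close>.\<close>
      define s where "s = 1 - 1 / B"
      have s: "0 \<le> s" "s < 1"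
        using that by (auto simp: s_def)
      have "B = 1 / (1 - s)"
        using that by (simp add: s_def)
      also have "\<dots> \<le> h s"
        unfolding h_def using s w_min_pos w_max_pos by (intro divide_right_mono) auto
      finally show ?thesis
        using ge[of s] s w_min_pos \<open>r = 1\<close> by (auto intro: order_trans[of _ "ereal (h s)"])
    qed
    then have "ereal B \<le> sigma_hat W x" for B
      by (rule order_trans[rotated, of "ereal (max B 1)"]) auto
    then have "sigma_hat W x = \<infinity>"
      by (rule ereal_top)
    then show ?thesis
      by simp
  qed
qed

text \<open>For an admissible \<open>\<epsilon> \<ge> 1\<close>, the inequality of
  \<open>tau_hat_ge\<close> is solved for \<open>\<epsilon>\<close>, which is possible when
  \<open>r < 1\<close>.\<close>

lemma sigma_hat_upper_bound:
  "sigma_hat W x \<le> (tau_hat W x + ereal (w_min W)) / ((1 - tau_hat W x) * ereal (w_min W))"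
proof -
  obtain r where r: "tau_hat W x = ereal r" "0 \<le> r" "r \<le> 1"
    by (rule tau_hat_real)
  define m where "m = w_min W"
  have m: "m > 0"
    using w_min_pos by (simp add: m_def)
  show ?thesis
  proof (cases "r < 1")
    case True
    have "\<epsilon> \<le> (r + m) / ((1 - r) * m)"
      if "Q0 > 0" and approx: "\<forall>Q>Q0. \<forall>w\<in>W. \<exists>(p :: int ^ 'n) (q :: int).
       w_quasinorm w (of_int q *\<^sub>R x - (\<chi> i. of_int (p $ i))) \<le> Q powr (- \<epsilon>)
       \<and> 0 < q \<and> of_int q \<le> Q" for \<epsilon> Q0
    proof (cases "\<epsilon> \<ge> 1")
      case eps: True
      have "m * (\<epsilon> - 1) / (1 + \<epsilon> * m) \<le> r"
        using tau_hat_ge[OF \<open>Q0 > 0\<close> eps, of x] approx by (simp add: r(1) m_def)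
      moreover have "1 + \<epsilon> * m > 0"
        using m eps by (intro add_pos_nonneg) auto
      ultimately have "\<epsilon> * ((1 - r) * m) \<le> r + m"
        by (simp add: field_simps)
      then show ?thesis
        using True m by (simp add: pos_le_divide_eq)
    next
      case False
      \<comment> \<open>An exponent below 1 is harmless, because the claimed bound is at least 1
        when \<open>r \<ge> 0\<close>.\<close>
      have "\<epsilon> * ((1 - r) * m) \<le> 1 * ((1 - r) * m)"
        using False True m by (intro mult_right_mono) auto
      also have "\<dots> \<le> r + m"
        using r(2) m by (simp add: algebra_simps)
      finally show ?thesis
        using True m by (simp add: pos_le_divide_eq)
    qed
    then have "sigma_hat W x \<le> ereal ((r + m) / ((1 - r) * m))"
      unfolding sigma_hat_def by (intro SUP_least) auto
    then show ?thesis
      using True m by (simp add: r(1) m_def one_ereal_def)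
  next
    case False
    with r have "tau_hat W x = 1"
      by (simp add: one_ereal_def)
    \<comment> \<open>The denominator is 0 and the numerator \<open>1 + w_min W\<close> is positive,
      so the quotient is \<open>\<infinity>\<close> in \<open>ereal\<close>.\<close>
    then show ?thesis
      using w_min_pos by (simp add: one_ereal_def zero_ereal_def[symmetric] divide_ereal_def)
  qed
qed

end

theorem theorem4p6:
  fixes W :: "(real ^ 'n) set" and x :: "real ^ 'n"
  assumes "W \<noteq> {}" and "\<And>w. w \<in> W \<Longrightarrow> is_weight w" and "w_min W > 0"
  shows "(tau_hat W x + ereal (w_max W)) / ((1 - tau_hat W x) * ereal (w_max W)) \<le> sigma_hat W x
       \<and> sigma_hat W x \<le> (tau_hat W x + ereal (w_min W)) / ((1 - tau_hat W x) * ereal (w_min W))"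
proof -
  interpret weight_family W
    using assms by unfold_locales
  show ?thesis
    using sigma_hat_lower_bound sigma_hat_upper_bound by blast
qed

end
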